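(* Let $Z$ be a Banach space and let $Y\subset Z$ be a closed subspace with $a:=\lambda(Y,Z)<\infty$, and assume that the infimum defining $\lambda(Y,Z)$ is not attained. Fix an integer $n\ge 2$ and put $W:=\Sigma_n(Y)\subset Z_\infty^n$. Then $$\lambda(W,Z_\infty^n)=\mu_n\,a,\qquad \mu_n:=2-\frac{2}{n},$$ and the infimum defining $\lambda(W,Z_\infty^n)$ is not attained.
   Context: Banach spaces are over a fixed scalar field $\mathbb K\in\{\mathbb R,\mathbb C\}$. For a closed subspace $E$ of a Banach space $F$, $\mathcal P(F,E)$ is the set of bounded linear operators $P\colon F\to E$ with $P|_E=\mathrm{Id}_E$ (bounded projections of $F$ onto $E$), and the relative projection constant is $\lambda(E,F):=\inf\{\|P\| : P\in\mathcal P(F,E)\}$ (equal to $\infty$ if $\mathcal P(F,E)=\emptyset$). The infimum is "not attained" if no $P\in\mathcal P(F,E)$ satisfies $\|P\|=\lambda(E,F)$. For a Banach space $X$ and an integer $n\ge 2$, $X_\infty^n$ is $X^n$ with the norm $\|(x_1,\dots,x_n)\|_\infty:=\max_{1\le i\le n}\|x_i\|$, and the zero-sum subspace is $\Sigma_n(X):=\{(x_1,\dots,x_n)\in X_\infty^n : \sum_{i=1}^n x_i=0\}$. Since $Y\subset Z$, $\Sigma_n(Y)\subset Y_\infty^n\subset Z_\infty^n$. *)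

theory Defs
  imports "HOL-Analysis.Analysis"
begin

text \<open>
  The scalar field is a type \<open>'k\<close> of class \<^class>\<open>real_normed_field\<close>. By the
  Gelfand--Mazur theorem these are, up to isometric isomorphism, exactly the real and the
  complex numbers. The underlying real Banach space is supplied by the type class
  \<^class>\<open>banach\<close>, and the \<open>'k\<close>-scalar multiplication must extend that of the reals.
\<close>

locale banach_space_over = vector_space smul
  for smul :: "'k::real_normed_field \<Rightarrow> 'a::banach \<Rightarrow> 'a" +
  assumes norm_smul: "norm (smul c x) = norm c * norm x"
    and smul_of_real: "smul (of_real r) x = r *\<^sub>R x"

text \<open>
  The ambient space \<open>F\<close> is the whole type. An operator \<open>F \<rightarrow> E\<close> is represented by a map of
  the type into itself with range in \<open>E\<close>; its operator norm is \<^const>\<open>onorm\<close>.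
\<close>

definition bounded_projections ::
  "('k::real_normed_field \<Rightarrow> 'a::real_normed_vector \<Rightarrow> 'a) \<Rightarrow> 'a set \<Rightarrow> ('a \<Rightarrow> 'a) set" where
  "bounded_projections smul E =
     {P. Vector_Spaces.linear smul smul P \<and> (\<exists>B. \<forall>x. norm (P x) \<le> B * norm x) \<and>
         range P \<subseteq> E \<and> (\<forall>x\<in>E. P x = x)}"

text \<open>In \<^typ>\<open>ereal\<close> the infimum of the empty set is \<open>\<infinity>\<close>.\<close>

definition rel_proj_const ::
  "('k::real_normed_field \<Rightarrow> 'a::real_normed_vector \<Rightarrow> 'a) \<Rightarrow> 'a set \<Rightarrow> ereal" where
  "rel_proj_const smul E = (INF P\<in>bounded_projections smul E. ereal (onorm P))"

definition proj_const_attained ::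
  "('k::real_normed_field \<Rightarrow> 'a::real_normed_vector \<Rightarrow> 'a) \<Rightarrow> 'a set \<Rightarrow> bool" where
  "proj_const_attained smul E \<longleftrightarrow>
     (\<exists>P\<in>bounded_projections smul E. ereal (onorm P) = rel_proj_const smul E)"

text \<open>
  The power \<open>X\<^sup>n\<close> with the maximum norm, where \<open>n = CARD('n)\<close>. A separate type is needed
  because the library equips \<open>'a ^ 'n\<close> with the Euclidean norm.
\<close>

typedef ('a, 'n) sup_power = "UNIV :: ('n \<Rightarrow> 'a) set"
  morphisms coord mk_sup_power ..

lemma coord_mk_sup_power [simp]: "coord (mk_sup_power f) = f"
  by (simp add: mk_sup_power_inverse)

lemma sup_power_eq_iff: "x = y \<longleftrightarrow> (\<forall>i. coord x i = coord y i)"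
  by (metis coord_inject ext)

instantiation sup_power :: (real_normed_vector, finite) real_normed_vector
begin

definition "0 = mk_sup_power (\<lambda>i. 0)"
definition "x + y = mk_sup_power (\<lambda>i. coord x i + coord y i)"
definition "x - y = mk_sup_power (\<lambda>i. coord x i - coord y i)"
definition "- x = mk_sup_power (\<lambda>i. - coord x i)"
definition "r *\<^sub>R x = mk_sup_power (\<lambda>i. r *\<^sub>R coord x i)"
definition "norm x = Max (range (\<lambda>i. norm (coord x i)))"
definition "sgn (x :: ('a, 'b) sup_power) = inverse (norm x) *\<^sub>R x"
definition "dist x (y :: ('a, 'b) sup_power) = norm (x - y)"
definition "(uniformity :: (('a, 'b) sup_power \<times> ('a, 'b) sup_power) filter) =
  (INF e\<in>{0<..}. principal {(x, y). dist x y < e})"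
definition "open (U :: ('a, 'b) sup_power set) \<longleftrightarrow>
  (\<forall>x\<in>U. \<forall>\<^sub>F (x', y) in uniformity. x' = x \<longrightarrow> y \<in> U)"

lemma norm_sup_power_le_iff:
  fixes x :: "('a, 'b) sup_power"
  shows "norm x \<le> b \<longleftrightarrow> (\<forall>i. norm (coord x i) \<le> b)"
  by (simp add: norm_sup_power_def)

lemma norm_coord_le:
  fixes x :: "('a, 'b) sup_power"
  shows "norm (coord x i) \<le> norm x"
  using norm_sup_power_le_iff by blast

instance
proof
  fix x y z :: "('a, 'b) sup_power" and r s :: real
  note defs = sup_power_eq_iff zero_sup_power_def plus_sup_power_def minus_sup_power_def
    uminus_sup_power_def scaleR_sup_power_def
  show "x + y + z = x + (y + z)" "x + y = y + x" "0 + x = x" "- x + x = 0" "x - y = x + - y"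
    "r *\<^sub>R (x + y) = r *\<^sub>R x + r *\<^sub>R y" "(r + s) *\<^sub>R x = r *\<^sub>R x + s *\<^sub>R x"
    "r *\<^sub>R s *\<^sub>R x = (r * s) *\<^sub>R x" "1 *\<^sub>R x = x"
    by (simp_all add: defs algebra_simps)
  show "dist x y = norm (x - y)" by (rule dist_sup_power_def)
  show "sgn x = inverse (norm x) *\<^sub>R x" by (rule sgn_sup_power_def)
  show "(uniformity :: (('a, 'b) sup_power \<times> ('a, 'b) sup_power) filter) =
    (INF e\<in>{0<..}. principal {(x, y). dist x y < e})" by (rule uniformity_sup_power_def)
  show "open U \<longleftrightarrow> (\<forall>x\<in>U. \<forall>\<^sub>F (x', y) in uniformity. x' = x \<longrightarrow> y \<in> U)"
    for U :: "('a, 'b) sup_power set" by (rule open_sup_power_def)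
  have nonneg: "0 \<le> norm w" for w :: "('a, 'b) sup_power"
    using norm_coord_le[of w undefined] norm_ge_zero order_trans by blast
  have "norm x = 0 \<longleftrightarrow> norm x \<le> 0" using nonneg[of x] by simp
  also have "\<dots> \<longleftrightarrow> x = 0" by (simp add: norm_sup_power_le_iff defs)
  finally show "norm x = 0 \<longleftrightarrow> x = 0" .
  show "norm (x + y) \<le> norm x + norm y"
    unfolding norm_sup_power_le_iff plus_sup_power_def
    by (auto intro: norm_triangle_le add_mono norm_coord_le)
  have "norm (r *\<^sub>R x) = Max ((\<lambda>t. \<bar>r\<bar> * t) ` range (\<lambda>i. norm (coord x i)))"
    by (simp add: norm_sup_power_def scaleR_sup_power_def image_image)
  also have "\<dots> = \<bar>r\<bar> * norm x"
    unfolding norm_sup_power_def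
    by (rule mono_Max_commute[symmetric]) (auto simp: mono_def intro: mult_left_mono)
  finally show "norm (r *\<^sub>R x) = \<bar>r\<bar> * norm x" .
qed

end

lemma coord_sup_power [simp]:
  "coord 0 i = 0" "coord (x + y) i = coord x i + coord y i"
  "coord (x - y) i = coord x i - coord y i" "coord (- x) i = - coord x i"
  "coord (r *\<^sub>R x) i = r *\<^sub>R coord x i"
  by (simp_all add: zero_sup_power_def plus_sup_power_def minus_sup_power_def
      uminus_sup_power_def scaleR_sup_power_def)

instance sup_power :: (banach, finite) banach
proof
  fix X :: "nat \<Rightarrow> ('a, 'b) sup_power"
  assume X: "Cauchy X"
  have "Cauchy (\<lambda>m. coord (X m) i)" for i
  proof (rule CauchyI)
    fix e :: real assume "0 < e"
    then obtain M where "\<And>m n. m \<ge> M \<Longrightarrow> n \<ge> M \<Longrightarrow> norm (X m - X n) < e"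
      using CauchyD[OF X] by blast
    then show "\<exists>M. \<forall>m\<ge>M. \<forall>n\<ge>M. norm (coord (X m) i - coord (X n) i) < e"
      by (metis coord_sup_power(3) norm_coord_le order_le_less_trans)
  qed
  then have "\<forall>i. \<exists>l. (\<lambda>m. coord (X m) i) \<longlonglongrightarrow> l"
    using Cauchy_convergent convergent_def by blast
  then obtain l where l: "\<And>i. (\<lambda>m. coord (X m) i) \<longlonglongrightarrow> l i" by metis
  have "X \<longlonglongrightarrow> mk_sup_power l"
  proof (rule tendstoI)
    fix e :: real assume e: "0 < e"
    have "\<forall>\<^sub>F m in sequentially. \<forall>i. dist (coord (X m) i) (l i) < e / 2"
      using tendstoD[OF l, of "e / 2"] e by (simp add: eventually_all_finite)
    then show "\<forall>\<^sub>F m in sequentially. dist (X m) (mk_sup_power l) < e"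
    proof eventually_elim
      case (elim m)
      then have "norm (X m - mk_sup_power l) \<le> e / 2"
        unfolding norm_sup_power_le_iff by (auto simp: dist_norm intro: less_imp_le)
      with e show ?case by (simp add: dist_norm)
    qed
  qed
  then show "convergent X" by (auto simp: convergent_def)
qed

definition smul_sup_power ::
  "('k \<Rightarrow> 'a \<Rightarrow> 'a) \<Rightarrow> 'k \<Rightarrow> ('a, 'n) sup_power \<Rightarrow> ('a, 'n) sup_power" where
  "smul_sup_power smul c x = mk_sup_power (\<lambda>i. smul c (coord x i))"

lemma banach_space_over_sup_power:
  fixes smul :: "'k::real_normed_field \<Rightarrow> 'a::banach \<Rightarrow> 'a"
  assumes "banach_space_over smul"
  shows "banach_space_over
    (smul_sup_power smul :: 'k \<Rightarrow> ('a, 'n::finite) sup_power \<Rightarrow> ('a, 'n) sup_power)"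
proof -
  interpret banach_space_over smul by fact
  show ?thesis
  proof
    fix c d :: 'k and r :: real and x y :: "('a, 'n) sup_power"
    let ?s = "smul_sup_power smul"
    show "?s c (x + y) = ?s c x + ?s c y" "?s (c + d) x = ?s c x + ?s d x"
      "?s c (?s d x) = ?s (c * d) x" "?s 1 x = x" "?s (of_real r) x = r *\<^sub>R x"
      by (simp_all add: sup_power_eq_iff smul_sup_power_def scale_right_distrib
          scale_left_distrib smul_of_real)
    have "norm (?s c x) = Max ((\<lambda>t. norm c * t) ` range (\<lambda>i. norm (coord x i)))"
      by (simp add: norm_sup_power_def smul_sup_power_def norm_smul image_image)
    also have "\<dots> = norm c * norm x"
      unfolding norm_sup_power_def
      by (rule mono_Max_commute[symmetric]) (auto simp: mono_def intro: mult_left_mono)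
    finally show "norm (?s c x) = norm c * norm x" .
  qed
qed

text \<open>\<open>\<Sigma>\<^sub>n(Y)\<close>, regarded as a subset of the power of the ambient space of \<open>Y\<close>.\<close>

definition zero_sum_subspace :: "'a::real_normed_vector set \<Rightarrow> ('a, 'n::finite) sup_power set" where
  "zero_sum_subspace Y = {x. (\<forall>i. coord x i \<in> Y) \<and> (\<Sum>i\<in>UNIV. coord x i) = 0}"

end

theory Submission
  imports Defs
begin

text \<open>
  Write \<open>n = CARD('n)\<close> and \<open>\<mu> = 2 - 2 / n\<close>. Projections onto \<open>Y\<close> and onto \<open>\<Sigma>\<^sub>n(Y)\<close> can be turned
  into each other at the exact exchange rate \<open>\<mu>\<close> for the norms.

  From a projection \<open>P\<close> onto \<open>Y\<close>, subtracting the mean and then applying \<open>P\<close> coordinatewise gives a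
  projection onto \<open>\<Sigma>\<^sub>n(Y)\<close> of norm at most \<open>\<mu> \<parallel>P\<parallel>\<close>, because subtracting the mean has norm at
  most \<open>(1 - 1/n) + (n - 1)/n = \<mu>\<close> (\<open>lift_projection\<close>).

  Conversely, let \<open>Q\<close> be a projection onto \<open>\<Sigma>\<^sub>n(Y)\<close>. Averaging \<open>Q\<close> over all permutations of the
  coordinates would give an operator of the form just described, for some \<open>P\<close>; this \<open>P\<close> is the
  trace of the operator matrix of \<open>Q\<close> divided by \<open>n - 1\<close>, so it can be written down without
  averaging. Let \<open>e\<^sub>i u\<close> be the vector with \<open>u\<close> at place \<open>i\<close> and zeros elsewhere and \<open>d u\<close> the
  constant vector. As \<open>Q\<close> has zero-sum values, the term \<open>Q (d u)\<close> disappears as soon as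
  the \<open>i\<close>-th coordinates of \<open>Q (c e\<^sub>i u - d u)\<close> are summed over \<open>i\<close>, which leaves
  \<open>c (n - 1) P u\<close>. With \<open>c = n\<close> and \<open>u \<in> Y\<close> the vector \<open>c e\<^sub>i u - d u\<close> lies in \<open>\<Sigma>\<^sub>n(Y)\<close> and is
  fixed by \<open>Q\<close>, and \<open>P u = u\<close> follows; with \<open>c = 2\<close> it has entries \<open>\<plusminus>u\<close>, hence norm \<open>\<parallel>u\<parallel>\<close>, and
  \<open>\<mu> \<parallel>P\<parallel> \<le> \<parallel>Q\<parallel>\<close> follows (\<open>compress_projection\<close>).

  The two infima therefore differ by the factor \<open>\<mu>\<close>, and a \<open>Q\<close> attaining its infimum would
  yield a \<open>P\<close> attaining the infimum for \<open>Y\<close>.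
\<close>

section \<open>Constant vectors, unit vectors and the mean\<close>

definition single_coord :: "'n \<Rightarrow> 'a::zero \<Rightarrow> ('a, 'n) sup_power" where
  "single_coord i u = mk_sup_power (\<lambda>k. if k = i then u else 0)"

definition const_coord :: "'a \<Rightarrow> ('a, 'n) sup_power" where
  "const_coord u = mk_sup_power (\<lambda>_. u)"

definition mean :: "('a::real_vector, 'n::finite) sup_power \<Rightarrow> 'a" where
  "mean x = (1 / real CARD('n)) *\<^sub>R (\<Sum>i\<in>UNIV. coord x i)"

lemma sum_deviation_from_mean:
  fixes x :: "('a::real_normed_vector, 'n::finite) sup_power"
  shows "(\<Sum>i\<in>UNIV. coord x i - mean x) = 0"
  by (simp add: sum_subtractf mean_def sum_constant_scaleR)

text \<open>
  The coefficient of \<open>coord x i\<close> in the deviation is \<open>1 - 1/n\<close>, the other \<open>n - 1\<close> coefficients are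
  \<open>- 1/n\<close>; the bound is the sum of their absolute values.
\<close>

lemma norm_deviation_from_mean_le:
  fixes x :: "('a::real_normed_vector, 'n::finite) sup_power"
  shows "norm (coord x i - mean x) \<le> (2 - 2 / real CARD('n)) * norm x"
proof -
  let ?n = "real CARD('n)"
  let ?R = "\<Sum>j\<in>UNIV - {i}. coord x j"
  have n: "?n \<ge> 1" by (simp add: Suc_leI)
  have "norm ?R \<le> (\<Sum>j\<in>UNIV - {i}. norm x)"
    by (intro order_trans[OF norm_sum] sum_mono norm_coord_le)
  also have "\<dots> = (?n - 1) * norm x"
    by (simp add: card_Diff_singleton of_nat_diff Suc_leI)
  finally have R: "norm ?R \<le> (?n - 1) * norm x" .
  have "coord x i - mean x = (1 - 1 / ?n) *\<^sub>R coord x i - (1 / ?n) *\<^sub>R ?R"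
    unfolding mean_def by (subst sum.remove[of _ i]) (simp_all add: algebra_simps)
  also have "norm \<dots> \<le> (1 - 1 / ?n) * norm (coord x i) + (1 / ?n) * norm ?R"
    using n by (intro order_trans[OF norm_triangle_ineq4]) simp
  also have "\<dots> \<le> (1 - 1 / ?n) * norm x + (1 / ?n) * ((?n - 1) * norm x)"
    using n by (intro add_mono mult_left_mono norm_coord_le R) simp_all
  also have "\<dots> = (2 - 2 / ?n) * norm x"
    using n by (simp add: field_simps)
  finally show ?thesis .
qed

section \<open>Bounded projections as real operators\<close>

context banach_space_over
begin

lemma smul_scaleR: "smul c (r *\<^sub>R x) = r *\<^sub>R smul c x"
  by (metis mult.commute scale_scale smul_of_real)

lemma subspace_scaleR: "subspace E \<Longrightarrow> x \<in> E \<Longrightarrow> r *\<^sub>R x \<in> E"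
  by (metis smul_of_real subspace_scale)

lemma bounded_projections_bounded_linear:
  assumes "P \<in> bounded_projections smul E"
  shows "bounded_linear P"
proof -
  obtain B where lin: "Vector_Spaces.linear smul smul P"
    and B: "\<And>x. norm (P x) \<le> B * norm x"
    using assms by (auto simp: bounded_projections_def)
  interpret P: Vector_Spaces.linear smul smul P by (rule lin)
  show ?thesis
    by (rule bounded_linear_intro[where K = B])
      (use B in \<open>simp_all add: P.add P.scale mult.commute flip: smul_of_real\<close>)
qed

lemma rel_proj_const_nonneg: "0 \<le> rel_proj_const smul E"
  unfolding rel_proj_const_def
  by (intro INF_greatest) (simp add: onorm_pos_le bounded_projections_bounded_linear)

section \<open>From the subspace to the zero-sum subspace\<close>

lemma lift_projection:
  assumes P: "P \<in> bounded_projections smul Y"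
  defines "Q \<equiv> \<lambda>x :: ('a, 'n::finite) sup_power. mk_sup_power (\<lambda>i. P (coord x i - mean x))"
  shows "Q \<in> bounded_projections (smul_sup_power smul) (zero_sum_subspace Y)"
    and "onorm Q \<le> (2 - 2 / real CARD('n)) * onorm P"
proof -
  let ?\<mu> = "2 - 2 / real CARD('n)"
  let ?S = "smul_sup_power smul :: 'k \<Rightarrow> ('a, 'n) sup_power \<Rightarrow> _"
  have blin: "bounded_linear P" by (rule bounded_projections_bounded_linear[OF P])
  interpret P: Vector_Spaces.linear smul smul P
    using P by (simp add: bounded_projections_def)
  interpret S: banach_space_over ?S
    by (rule banach_space_over_sup_power) unfold_locales
  have mean_add: "mean (x + y) = mean x + mean y" for x y :: "('a, 'n) sup_power"
    by (simp add: mean_def sum.distrib scaleR_right_distrib)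
  have mean_smul: "mean (?S c x) = smul c (mean x)" for c x
    by (simp add: mean_def smul_sup_power_def smul_scaleR scale_sum_right)
  have "Vector_Spaces.linear ?S ?S Q"
  proof unfold_locales
    show "Q (x + y) = Q x + Q y" for x y
      by (simp add: Q_def sup_power_eq_iff mean_add add_diff_add P.add)
    show "Q (?S c x) = ?S c (Q x)" for c x
      unfolding Q_def sup_power_eq_iff mean_smul
      by (simp add: smul_sup_power_def P.scale flip: scale_right_diff_distrib)
  qed
  moreover have bound: "norm (Q x) \<le> (?\<mu> * onorm P) * norm x" for x
    unfolding norm_sup_power_le_iff
  proof
    fix i
    have "norm (coord (Q x) i) \<le> onorm P * norm (coord x i - mean x)"
      using onorm[OF blin] by (simp add: Q_def)
    also have "\<dots> \<le> onorm P * (?\<mu> * norm x)"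
      by (intro mult_left_mono norm_deviation_from_mean_le onorm_pos_le blin)
    finally show "norm (coord (Q x) i) \<le> (?\<mu> * onorm P) * norm x"
      by (simp add: mult_ac)
  qed
  moreover have "Q x \<in> zero_sum_subspace Y" for x
  proof -
    have "(\<Sum>i\<in>UNIV. coord (Q x) i) = P (\<Sum>i\<in>UNIV. coord x i - mean x)"
      by (simp only: Q_def coord_mk_sup_power P.sum)
    with P show ?thesis
      by (auto simp: zero_sum_subspace_def Q_def sum_deviation_from_mean bounded_projections_def
          P.zero)
  qed
  moreover have "Q x = x" if "x \<in> zero_sum_subspace Y" for x
    using that P
    by (auto simp: zero_sum_subspace_def Q_def mean_def sup_power_eq_iff bounded_projections_def)
  ultimately show "Q \<in> bounded_projections ?S (zero_sum_subspace Y)"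
    unfolding bounded_projections_def by blast
  have "real CARD('n) \<ge> 1" by (simp add: Suc_leI)
  then have "0 \<le> ?\<mu>" by (simp add: field_simps)
  then show "onorm Q \<le> ?\<mu> * onorm P"
    by (intro onorm_bound bound mult_nonneg_nonneg onorm_pos_le blin)
qed

section \<open>From the zero-sum subspace to the subspace\<close>

text \<open>
  For the estimate, the \<open>n\<close> test vectors \<open>2 e\<^sub>i u - d u\<close> of norm \<open>\<parallel>u\<parallel>\<close> give
  \<open>2 (n - 1) \<parallel>P u\<parallel> \<le> n \<parallel>Q\<parallel> \<parallel>u\<parallel>\<close>, and \<open>2 (n - 1) / n = \<mu>\<close>.
\<close>

lemma compress_projection:
  fixes Q :: "('a, 'n::finite) sup_power \<Rightarrow> ('a, 'n) sup_power"
  assumes Y: "subspace Y" and n2: "CARD('n) \<ge> 2"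
    and Q: "Q \<in> bounded_projections (smul_sup_power smul) (zero_sum_subspace Y)"
  defines "P \<equiv> \<lambda>u. (1 / (real CARD('n) - 1)) *\<^sub>R (\<Sum>i\<in>UNIV. coord (Q (single_coord i u)) i)"
  shows "P \<in> bounded_projections smul Y"
    and "(2 - 2 / real CARD('n)) * onorm P \<le> onorm Q"
proof -
  let ?n = "real CARD('n)"
  let ?\<mu> = "2 - 2 / ?n"
  let ?S = "smul_sup_power smul :: 'k \<Rightarrow> ('a, 'n) sup_power \<Rightarrow> _"
  let ?T = "\<lambda>u. \<Sum>i\<in>UNIV. coord (Q (single_coord i u)) i"
  have n: "?n \<ge> 2" using n2 by simp
  then have \<mu>: "?\<mu> > 0" by (simp add: field_simps)
  interpret S: banach_space_over ?S
    by (rule banach_space_over_sup_power) unfold_locales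
  interpret Q: Vector_Spaces.linear ?S ?S Q
    using Q by (simp add: bounded_projections_def)
  have blin: "bounded_linear Q" by (rule S.bounded_projections_bounded_linear[OF Q])
  interpret Qb: bounded_linear Q by (rule blin)
  have Q_range: "coord (Q x) i \<in> Y" "(\<Sum>i\<in>UNIV. coord (Q x) i) = 0" for x i
    using Q by (auto simp: bounded_projections_def zero_sum_subspace_def)

  have trace: "(\<Sum>i\<in>UNIV. coord (Q (c *\<^sub>R single_coord i u - const_coord u)) i)
      = (c * (?n - 1)) *\<^sub>R P u" for c u
    using n Q_range(2)[of "const_coord u"]
    by (simp add: Qb.diff Qb.scaleR sum_subtractf P_def flip: scaleR_sum_right)

  have "P y = y" if y: "y \<in> Y" for y
  proof -
    have "?n *\<^sub>R single_coord i y - const_coord y \<in> zero_sum_subspace Y" for i :: 'n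
      using y Y
      by (auto simp: zero_sum_subspace_def single_coord_def const_coord_def sum_subtractf
          subspace_diff subspace_neg subspace_scaleR sum_constant_scaleR
          simp flip: scaleR_sum_right)
    then have "Q (?n *\<^sub>R single_coord i y - const_coord y)
        = ?n *\<^sub>R single_coord i y - const_coord y" for i
      using Q by (simp add: bounded_projections_def)
    then have "(?n * (?n - 1)) *\<^sub>R P y
        = (\<Sum>i\<in>UNIV. coord (?n *\<^sub>R single_coord i y - const_coord y :: ('a, 'n) sup_power) i)"
      by (simp flip: trace)
    also have "\<dots> = (?n * (?n - 1)) *\<^sub>R y"
      by (simp add: single_coord_def const_coord_def sum_constant_scaleR algebra_simps)
    finally show ?thesis using n by simp
  qed
  moreover have bound: "norm (P u) \<le> (onorm Q / ?\<mu>) * norm u" for u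
  proof -
    let ?v = "\<lambda>i. 2 *\<^sub>R single_coord i u - const_coord u :: ('a, 'n) sup_power"
    have v: "norm (?v i) \<le> norm u" for i
      by (auto simp: norm_sup_power_le_iff single_coord_def const_coord_def scaleR_2)
    have "(2 * (?n - 1)) * norm (P u) = norm (\<Sum>i\<in>UNIV. coord (Q (?v i)) i)"
      using n by (simp only: trace norm_scaleR) simp
    also have "\<dots> \<le> (\<Sum>i\<in>(UNIV :: 'n set). onorm Q * norm u)"
      by (intro order_trans[OF norm_sum] sum_mono order_trans[OF norm_coord_le]
          order_trans[OF onorm[OF blin]] mult_left_mono v onorm_pos_le blin)
    also have "\<dots> = ?n * (onorm Q * norm u)" by simp
    finally show ?thesis using n by (simp add: field_simps)
  qed
  moreover have "Vector_Spaces.linear smul smul P"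
  proof unfold_locales
    have "single_coord i (x + y) = single_coord i x + single_coord i y" for i :: 'n and x y :: 'a
      by (simp add: sup_power_eq_iff single_coord_def)
    then show "P (x + y) = P x + P y" for x y
      by (simp add: P_def Qb.add sum.distrib scaleR_right_distrib)
    have "single_coord i (smul c x) = ?S c (single_coord i x)" for i c x
      by (simp add: sup_power_eq_iff single_coord_def smul_sup_power_def)
    then show "P (smul c x) = smul c (P x)" for c x
      by (simp add: P_def Q.scale smul_scaleR scale_sum_right)
        (simp add: smul_sup_power_def)
  qed
  moreover have "P u \<in> Y" for u
    unfolding P_def by (intro subspace_scaleR subspace_sum Y Q_range)
  ultimately show "P \<in> bounded_projections smul Y"
    unfolding bounded_projections_def by blast
  have "onorm P \<le> onorm Q / ?\<mu>"
    using \<mu> by (intro onorm_bound bound divide_nonneg_pos onorm_pos_le blin)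
  with \<mu> show "?\<mu> * onorm P \<le> onorm Q" by (simp add: pos_le_divide_eq mult.commute)
qed

end

section \<open>The relative projection constant of the zero-sum subspace\<close>

theorem lemma3p2:
  fixes smul :: "'k::real_normed_field \<Rightarrow> 'z::banach \<Rightarrow> 'z"
    and Y :: "'z set"
    and W :: "('z, 'n::finite) sup_power set"
  assumes "banach_space_over smul"
    and "module.subspace smul Y" and "closed Y"
    and "rel_proj_const smul Y < \<infinity>"
    and "\<not> proj_const_attained smul Y"
    and "CARD('n) \<ge> 2"
    and "W = zero_sum_subspace Y"
  shows "rel_proj_const (smul_sup_power smul) W
           = ereal (2 - 2 / real CARD('n)) * rel_proj_const smul Y
       \<and> \<not> proj_const_attained (smul_sup_power smul) W"
proof -
  interpret banach_space_over smul by fact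
  let ?\<mu> = "2 - 2 / real CARD('n)"
  let ?S = "smul_sup_power smul :: 'k \<Rightarrow> ('z, 'n) sup_power \<Rightarrow> _"
  have \<mu>: "?\<mu> > 0" using \<open>CARD('n) \<ge> 2\<close> by (simp add: field_simps)
  obtain a where a: "rel_proj_const smul Y = ereal a"
    using rel_proj_const_nonneg[of Y] assms(4) by (cases "rel_proj_const smul Y") auto
  have a_le: "a \<le> onorm P" if "P \<in> bounded_projections smul Y" for P
    using INF_lower[OF that, of "\<lambda>P. ereal (onorm P)"] a by (simp add: rel_proj_const_def)

  have compress: "\<exists>P\<in>bounded_projections smul Y. ?\<mu> * onorm P \<le> onorm Q"
    if "Q \<in> bounded_projections ?S W" for Q
    using compress_projection[OF assms(2,6)] that unfolding \<open>W = _\<close> by blast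

  have "rel_proj_const ?S W = ereal (?\<mu> * a)"
  proof (rule antisym)
    have "rel_proj_const ?S W / ereal ?\<mu> \<le> ereal (onorm P)"
      if P: "P \<in> bounded_projections smul Y" for P
    proof -
      obtain Q where "Q \<in> bounded_projections ?S W" "onorm Q \<le> ?\<mu> * onorm P"
        using lift_projection[OF P] unfolding \<open>W = _\<close> by blast
      then have "rel_proj_const ?S W \<le> ereal (?\<mu> * onorm P)"
        unfolding rel_proj_const_def by (intro INF_lower2) auto
      with \<mu> show ?thesis by (simp add: ereal_divide_le_pos)
    qed
    then have "rel_proj_const ?S W / ereal ?\<mu> \<le> rel_proj_const smul Y"
      unfolding rel_proj_const_def[of smul Y] by (rule INF_greatest)
    with \<mu> show "rel_proj_const ?S W \<le> ereal (?\<mu> * a)"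
      by (simp add: a ereal_divide_le_pos)
    show "ereal (?\<mu> * a) \<le> rel_proj_const ?S W"
      unfolding rel_proj_const_def
    proof (rule INF_greatest)
      fix Q assume "Q \<in> bounded_projections ?S W"
      then obtain P where "P \<in> bounded_projections smul Y" "?\<mu> * onorm P \<le> onorm Q"
        using compress by blast
      then have "?\<mu> * a \<le> onorm Q"
        using \<mu> by (intro order_trans[OF mult_left_mono[OF a_le]]) simp_all
      then show "ereal (?\<mu> * a) \<le> ereal (onorm Q)" by simp
    qed
  qed
  moreover have False if Q: "Q \<in> bounded_projections ?S W" "onorm Q = ?\<mu> * a" for Q
  proof -
    obtain P where P: "P \<in> bounded_projections smul Y" "?\<mu> * onorm P \<le> ?\<mu> * a"
      using compress[OF Q(1)] Q(2) by auto
    then have "onorm P = a"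
      using \<mu> a_le[OF P(1)] by (simp only: mult_le_cancel_left_pos)
    with P(1) a assms(5) show False by (auto simp: proj_const_attained_def)
  qed
  ultimately show ?thesis by (auto simp: a proj_const_attained_def)
qed

end
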